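(* Let $G$ be a simple, strongly connected and balanced directed graph on vertex set $\{1,\dots,n\}$, and let $R=[r_{ij}]$ be its resistance matrix. Then every off-diagonal entry of $R$ is positive (so $R$ is a non-negative matrix), and $r_{ik}\le r_{ij}+r_{jk}$ for all vertices $i,j,k$.
   Context: For a simple directed graph $G=(V,E)$ with $V=\{1,\dots,n\}$, the adjacency matrix is $A=[a_{ij}]$ with $a_{ij}=1$ if $(i,j)\in E$ (a directed edge from $i$ to $j$) and $0$ otherwise. $G$ is balanced if for every vertex the indegree (column sum of $A$) equals the outdegree (row sum of $A$); it is strongly connected if every ordered pair of vertices is joined by a directed path. The Laplacian is $L=\operatorname{Diag}(A\mathbf{1})-A$, where $\mathbf{1}$ is the all-ones vector. With $L^\dagger=[l^\dagger_{ij}]$ the Moore–Penrose inverse of $L$, the resistance between $i$ and $j$ is $r_{ij}=l^\dagger_{ii}+l^\dagger_{jj}-2l^\dagger_{ij}$, and $R=[r_{ij}]$ is the resistance matrix. *)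

theory Defs
  imports "HOL-Analysis.Analysis" "Graph_Theory.Digraph_Component" "Graph_Theory.Pair_Digraph"
begin

definition balanced :: "'n pair_pre_digraph \<Rightarrow> bool" where
  "balanced G \<longleftrightarrow> (\<forall>v \<in> pverts G. in_degree (with_proj G) v = out_degree (with_proj G) v)"

definition adj_matrix :: "'n::finite pair_pre_digraph \<Rightarrow> real^'n^'n" where
  "adj_matrix G = (\<chi> i j. if (i, j) \<in> parcs G then 1 else 0)"

definition Diag :: "'a::zero^'n \<Rightarrow> 'a^'n^'n" where
  "Diag v = (\<chi> i j. if i = j then v $ i else 0)"

text \<open>The vector \<open>1\<close> below is the all-ones vector.\<close>

definition laplacian :: "'n::finite pair_pre_digraph \<Rightarrow> real^'n^'n" where
  "laplacian G = Diag (adj_matrix G *v 1) - adj_matrix G"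

definition is_mp_inverse :: "real^'n^'m \<Rightarrow> real^'m^'n \<Rightarrow> bool" where
  "is_mp_inverse A X \<longleftrightarrow>
     A ** X ** A = A \<and> X ** A ** X = X \<and>
     transpose (A ** X) = A ** X \<and> transpose (X ** A) = X ** A"

definition mp_inverse :: "real^'n^'m \<Rightarrow> real^'m^'n" where
  "mp_inverse A = (THE X. is_mp_inverse A X)"

definition resistance_matrix :: "'n::finite pair_pre_digraph \<Rightarrow> real^'n^'n" where
  "resistance_matrix G =
     (\<chi> i j. mp_inverse (laplacian G) $ i $ i + mp_inverse (laplacian G) $ j $ j
             - 2 * mp_inverse (laplacian G) $ i $ j)"

lemma out_degree_eq_row_sum:
  fixes G :: "'n::finite pair_pre_digraph"
  shows "real (out_degree (with_proj G) v) = (\<Sum>j\<in>UNIV. adj_matrix G $ v $ j)"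
proof -
  have "out_arcs (with_proj G) v = Pair v ` {j. (v, j) \<in> parcs G}"
    by (auto simp: out_arcs_def)
  then show ?thesis
    by (simp add: out_degree_def adj_matrix_def card_image inj_on_def sum.If_cases)
qed

lemma in_degree_eq_column_sum:
  fixes G :: "'n::finite pair_pre_digraph"
  shows "real (in_degree (with_proj G) v) = (\<Sum>i\<in>UNIV. adj_matrix G $ i $ v)"
proof -
  have "in_arcs (with_proj G) v = (\<lambda>i. (i, v)) ` {i. (i, v) \<in> parcs G}"
    by (auto simp: in_arcs_def)
  then show ?thesis
    by (simp add: in_degree_def adj_matrix_def card_image inj_on_def sum.If_cases)
qed

lemma is_mp_inverse_unique:
  fixes A :: "real^'n^'m"
  assumes X: "is_mp_inverse A X" and Y: "is_mp_inverse A Y"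
  shows "X = Y"
proof -
  have AX: "A ** X = A ** Y"
  proof -
    have "A ** X = transpose (A ** Y ** A ** X)"
      using X Y by (simp add: is_mp_inverse_def)
    also have "\<dots> = transpose (A ** X) ** transpose (A ** Y)"
      by (simp add: matrix_transpose_mul matrix_mul_assoc)
    also have "\<dots> = A ** X ** A ** Y"
      using X Y by (simp add: is_mp_inverse_def matrix_mul_assoc)
    finally show ?thesis using X by (simp add: is_mp_inverse_def)
  qed
  have XA: "X ** A = Y ** A"
  proof -
    have "X ** A = X ** (A ** Y ** A)"
      using Y by (simp add: is_mp_inverse_def)
    then have "X ** A = transpose (X ** A ** (Y ** A))"
      using X by (simp add: is_mp_inverse_def matrix_mul_assoc)
    also have "\<dots> = transpose (Y ** A) ** transpose (X ** A)"
      by (simp add: matrix_transpose_mul)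
    also have "\<dots> = Y ** A ** (X ** A)"
      using X Y by (simp add: is_mp_inverse_def)
    also have "\<dots> = Y ** (A ** X ** A)"
      by (simp add: matrix_mul_assoc)
    finally show ?thesis using X by (simp add: is_mp_inverse_def)
  qed
  have "X = X ** (A ** X)"
    using X by (simp add: is_mp_inverse_def matrix_mul_assoc)
  also have "\<dots> = X ** A ** Y"
    by (simp add: AX matrix_mul_assoc)
  also have "\<dots> = Y"
    using Y by (simp add: XA is_mp_inverse_def)
  finally show ?thesis .
qed

lemma least_squares_inverse_exists:
  fixes A :: "real^'n^'m"
  obtains C where "A ** C ** A = A" "transpose (A ** C) = A ** C"
proof -
  have "\<exists>x. transpose A *v (A *v x) = transpose A *v y" for y
  proof -
    let ?S = "range (\<lambda>x. A *v x)"
    have S: "span ?S = ?S"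
      by (simp add: linear_subspace_image span_eq_iff)
    obtain p z where p: "p \<in> span ?S" and z: "\<And>w. w \<in> span ?S \<Longrightarrow> orthogonal z w"
      and y: "y = p + z"
      using orthogonal_subspace_decomp_exists[of ?S y] by blast
    obtain x where x: "p = A *v x" using p S by auto
    have "(transpose A *v z) \<bullet> w = 0" for w
      using z[of "A *v w"] S
      by (metis dot_lmul_matrix orthogonal_def rangeI transpose_matrix_vector)
    then have "transpose A *v z = 0"
      by (metis inner_eq_zero_iff)
    then show ?thesis
      using x y by (auto simp: matrix_vector_right_distrib)
  qed
  then obtain f where f: "\<And>y. transpose A *v (A *v f y) = transpose A *v y"
    by metis
  define C :: "real^'m^'n" where "C = (\<chi> i j. f (axis j 1) $ i)"
  have col: "C *v axis j 1 = f (axis j 1)" for j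
    by (simp add: matrix_vector_mult_basis column_def C_def vec_eq_iff)
  have N: "transpose A ** A ** C = transpose A"
  proof -
    have "column j (transpose A ** A ** C) = column j (transpose A)" for j
      using f[of "axis j 1"]
      by (simp flip: matrix_vector_mult_basis add: matrix_vector_mul_assoc[symmetric] col)
    then show ?thesis
      by (simp add: column_def vec_eq_iff)
  qed
  have "transpose (A ** C) = transpose C ** (transpose A ** A ** C)"
    by (simp add: N matrix_transpose_mul)
  also have "\<dots> = transpose (A ** C) ** (A ** C)"
    by (simp add: matrix_transpose_mul matrix_mul_assoc)
  finally have idem: "transpose (A ** C) = transpose (A ** C) ** (A ** C)" .
  have sym: "transpose (A ** C) = A ** C"
    using arg_cong[OF idem, of transpose] idem by (simp add: matrix_transpose_mul)
  have "A ** C ** A = A"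
    using arg_cong[OF N, of transpose] sym
    by (simp add: matrix_transpose_mul matrix_mul_assoc)
  then show ?thesis using sym that by blast
qed

lemma is_mp_inverse_exists:
  fixes A :: "real^'n^'m"
  shows "\<exists>X. is_mp_inverse A X"
proof -
  obtain C where C: "A ** C ** A = A" "transpose (A ** C) = A ** C"
    by (rule least_squares_inverse_exists)
  obtain B where B: "transpose A ** B ** transpose A = transpose A"
    "transpose (transpose A ** B) = transpose A ** B"
    by (rule least_squares_inverse_exists)
  define D where "D = transpose B"
  have D: "A ** D ** A = A" "transpose (D ** A) = D ** A"
    using arg_cong[OF B(1), of transpose] B(2)
    by (simp_all add: D_def matrix_transpose_mul matrix_mul_assoc)
  have AX: "A ** (D ** A ** C) = A ** C"
    by (simp add: D(1) matrix_mul_assoc)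
  have XA: "D ** A ** C ** A = D ** A"
    using C(1) by (simp flip: matrix_mul_assoc)
  have "is_mp_inverse A (D ** A ** C)"
    unfolding is_mp_inverse_def AX XA using C D
    by (simp add: matrix_mul_assoc) (simp flip: matrix_mul_assoc)
  then show ?thesis by blast
qed

lemma is_mp_inverse_mp_inverse: "is_mp_inverse A (mp_inverse A)"
  unfolding mp_inverse_def
  by (rule theI') (blast intro: is_mp_inverse_exists is_mp_inverse_unique)

end

theory Submission
  imports Defs
begin

text \<open>
  Since \<open>G\<close> is strongly connected and balanced, the kernels of \<open>L\<close> and of its transpose are both
  spanned by the all-ones vector, so \<open>M = L\<^sup>\<dagger>\<close> satisfies \<open>L M = M L = I - J/n\<close>.
  Everything else is the maximum principle: \<open>(L u)\<^sub>i\<close> is the sum of \<open>u\<^sub>i - u\<^sub>a\<close> over the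
  out-neighbours \<open>a\<close> of \<open>i\<close>, so a vector with \<open>(L u)\<^sub>i \<le> 0\<close> for all \<open>i \<noteq> j\<close> is maximal at \<open>j\<close>.
  For \<open>u = M (e\<^sub>j - e\<^sub>k)\<close> we have \<open>L u = e\<^sub>j - e\<^sub>k\<close>, and \<open>u\<^sub>i \<le> u\<^sub>j\<close> is half the triangle inequality
  \<open>r\<^sub>i\<^sub>k \<le> r\<^sub>i\<^sub>j + r\<^sub>j\<^sub>k\<close>. For the \<open>j\<close>-th column of \<open>M\<close> the inequality at \<open>i \<noteq> j\<close> is strict, which
  gives \<open>m\<^sub>i\<^sub>j < m\<^sub>j\<^sub>j\<close>; the same argument for the reversed graph gives \<open>m\<^sub>i\<^sub>j < m\<^sub>i\<^sub>i\<close>, hence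
  \<open>r\<^sub>i\<^sub>j > 0\<close>.
\<close>

lemma Diag_row_sum_minus_mult_vec:
  fixes A :: "real^'n::finite^'n"
  shows "((Diag (A *v 1) - A) *v u) $ i = (\<Sum>a\<in>UNIV. A $ i $ a * (u $ i - u $ a))"
proof -
  have "((Diag (A *v 1) - A) *v u) $ i = (Diag (A *v 1) *v u) $ i - (A *v u) $ i"
    by (simp add: matrix_vector_mult_diff_rdistrib)
  also have "(Diag (A *v 1) *v u) $ i = (\<Sum>a\<in>UNIV. A $ i $ a) * u $ i"
    by (simp add: Diag_def matrix_vector_mult_def if_distrib[of "\<lambda>x. x * _"] cong: if_cong)
  finally show ?thesis
    by (simp add: matrix_vector_mult_def right_diff_distrib sum_subtractf sum_distrib_right)
qed

lemma is_mp_inverse_transpose: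
  assumes "is_mp_inverse A X"
  shows "is_mp_inverse (transpose A) (transpose X)"
proof -
  have "transpose A ** transpose X ** transpose A = transpose (A ** X ** A)"
    "transpose X ** transpose A ** transpose X = transpose (X ** A ** X)"
    by (simp_all add: matrix_transpose_mul matrix_mul_assoc)
  moreover have "transpose A ** transpose X = X ** A" "transpose X ** transpose A = A ** X"
    using assms by (simp_all add: is_mp_inverse_def flip: matrix_transpose_mul)
  ultimately show ?thesis
    using assms by (simp add: is_mp_inverse_def)
qed

text \<open>This class is closed under transposition, that is, under reversal of all arcs.
  Interpreting it at \<open>transpose A\<close> turns statements about columns of the inverse into
  statements about rows.\<close>

locale irreducible_balanced_matrix =
  fixes A :: "real^'n::finite^'n"
  assumes nonneg: "0 \<le> A $ i $ j"
    and irreducible: "(i, j) \<in> {(a, b). 0 < A $ a $ b}\<^sup>*"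
    and balanced: "transpose A *v 1 = A *v 1"
begin

definition L :: "real^'n^'n" where
  "L = Diag (A *v 1) - A"

lemma L_mult_vec: "(L *v u) $ i = (\<Sum>a\<in>UNIV. A $ i $ a * (u $ i - u $ a))"
  unfolding L_def by (rule Diag_row_sum_minus_mult_vec)

lemma irreducible_balanced_matrix_transpose: "irreducible_balanced_matrix (transpose A)"
proof
  show "(i, j) \<in> {(a, b). 0 < transpose A $ a $ b}\<^sup>*" for i j
  proof -
    have "{(a, b). 0 < transpose A $ a $ b} = {(a, b). 0 < A $ a $ b}\<inverse>"
      by (auto simp: transpose_def)
    then show ?thesis
      using irreducible[of j i] by (simp add: rtrancl_converse)
  qed
qed (use nonneg balanced in \<open>simp_all add: transpose_def\<close>)

text \<open>Balance makes the diagonals agree: the row sums of \<open>transpose A\<close> are the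
  column sums of \<open>A\<close>.\<close>

lemma transpose_L: "transpose L = irreducible_balanced_matrix.L (transpose A)"
  unfolding L_def irreducible_balanced_matrix.L_def[OF irreducible_balanced_matrix_transpose]
    balanced
  by (simp add: transpose_def Diag_def vec_eq_iff)

lemma L_mult_one: "L *v 1 = 0"
  by (simp add: vec_eq_iff L_mult_vec)

lemma maximum_principle:
  assumes u: "\<And>i. i \<noteq> j \<Longrightarrow> (L *v u) $ i \<le> 0"
  shows "u $ i \<le> u $ j"
proof -
  obtain m where "\<And>a. u $ a \<le> u $ m"
    using Max_in[of "range (($) u)"] Max_ge[of "range (($) u)"] by fastforce
  \<comment> \<open>The global maximum at \<open>m\<close> is carried along a path to
    \<open>j\<close>: at a vertex other than \<open>j\<close> the nonnegative summands have a sum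
    \<le> 0, so all vanish and the next vertex attains the maximum too.\<close>
  with irreducible[of m j] have "\<forall>a. u $ a \<le> u $ j"
  proof (induction m rule: converse_rtrancl_induct)
    case (step m b)
    show ?case
    proof (cases "m = j")
      case False
      have pos: "0 \<le> A $ m $ a * (u $ m - u $ a)" for a
        using nonneg step.prems by simp
      then have "(\<Sum>a\<in>UNIV. A $ m $ a * (u $ m - u $ a)) = 0"
        using u[OF False] by (intro antisym sum_nonneg) (simp_all add: L_mult_vec)
      then have "A $ m $ b * (u $ m - u $ b) = 0"
        using pos by (simp add: sum_nonneg_eq_0_iff)
      then have "u $ m = u $ b"
        using step.hyps by simp
      then show ?thesis
        using step.IH step.prems by simp
    qed (use step.prems in simp)
  qed simp
  then show ?thesis by blast
qed

lemma strict_maximum_principle: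
  assumes u: "\<And>i. i \<noteq> j \<Longrightarrow> (L *v u) $ i < 0" and "i \<noteq> j"
  shows "u $ i < u $ j"
proof (rule ccontr)
  assume "\<not> u $ i < u $ j"
  \<comment> \<open>The maximum is attained at \<open>j\<close>, hence also at
    \<open>i\<close>.\<close>
  then have "u $ a \<le> u $ i" for a
    using maximum_principle[of j u a] u by (smt (verit))
  then have "0 \<le> (L *v u) $ i"
    unfolding L_mult_vec using nonneg by (intro sum_nonneg) simp
  then show False
    using u[OF \<open>i \<noteq> j\<close>] by simp
qed

text \<open>For a kernel vector every index can serve as the exceptional one in the maximum
  principle.\<close>

lemma kernel_constant:
  assumes "L *v u = 0"
  shows "u $ i = u $ j"
  using maximum_principle[of i u j] maximum_principle[of j u i] assms by simp

text \<open>The matrix \<open>mat 1 - X ** L\<close> is the orthogonal projection onto the kernel of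
  \<open>L\<close>, the constant vectors. Its columns are constant, symmetry makes all its entries
  equal, and its row sums are 1.\<close>

lemma mp_inverse_mult_L:
  assumes X: "is_mp_inverse L X"
  shows "(X ** L) $ i $ j = (if i = j then 1 else 0) - 1 / real CARD('n)"
proof -
  define Q where "Q = mat 1 - X ** L"
  have "L *v (Q *v v) = 0" for v
    using X by (simp add: Q_def is_mp_inverse_def matrix_vector_mult_diff_rdistrib
        matrix_vector_mult_diff_distrib matrix_vector_mul_assoc matrix_mul_assoc)
  then have "L *v column j Q = 0" for j
    by (metis matrix_vector_mult_basis)
  then have col: "Q $ i $ j = Q $ k $ j" for i j k
    using kernel_constant[of "column j Q" i k] by (simp add: column_def)
  have "transpose Q = Q"
    using X by (simp add: Q_def is_mp_inverse_def transpose_def mat_def vec_eq_iff)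
  then have sym: "Q $ i $ j = Q $ j $ i" for i j
    by (metis transpose_def vec_lambda_beta)
  have const: "Q $ i $ k = Q $ i $ j" for k
    using col sym by metis
  have "Q *v 1 = 1"
    by (simp add: Q_def matrix_vector_mult_diff_rdistrib L_mult_one
        flip: matrix_vector_mul_assoc)
  then have "(\<Sum>k\<in>UNIV. Q $ i $ k) = 1"
    by (simp add: vec_eq_iff matrix_vector_mult_def)
  moreover have "(\<Sum>k\<in>UNIV. Q $ i $ k) = (\<Sum>k::'n\<in>UNIV. Q $ i $ j)"
    by (intro sum.cong refl const)
  ultimately have "real CARD('n) * Q $ i $ j = 1"
    by simp
  then have "Q $ i $ j = 1 / real CARD('n)"
    by (simp add: field_simps)
  then show ?thesis
    by (simp add: Q_def mat_def)
qed

lemma L_mult_mp_inverse: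
  assumes X: "is_mp_inverse L X"
  shows "(L ** X) $ i $ j = (if i = j then 1 else 0) - 1 / real CARD('n)"
proof -
  interpret T: irreducible_balanced_matrix "transpose A"
    by (rule irreducible_balanced_matrix_transpose)
  have "(L ** X) $ i $ j = (transpose X ** transpose L) $ j $ i"
    by (simp flip: matrix_transpose_mul) (simp add: transpose_def)
  also have "\<dots> = (if i = j then 1 else 0) - 1 / real CARD('n)"
    using T.mp_inverse_mult_L[of "transpose X" j i] is_mp_inverse_transpose[OF X]
    by (simp add: transpose_L eq_commute)
  finally show ?thesis .
qed

lemma L_mult_column_mp_inverse:
  assumes "is_mp_inverse L X"
  shows "(L *v column j X) $ i = (if i = j then 1 else 0) - 1 / real CARD('n)"
  using L_mult_mp_inverse[OF assms, of i j]
  by (simp add: matrix_vector_mult_def matrix_matrix_mult_def column_def)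

lemma mp_inverse_less_diagonal_column:
  assumes "is_mp_inverse L X" and "i \<noteq> j"
  shows "X $ i $ j < X $ j $ j"
  using strict_maximum_principle[of j "column j X" i] assms
  by (simp add: L_mult_column_mp_inverse) (simp add: column_def)

lemma mp_inverse_less_diagonal_row:
  assumes "is_mp_inverse L X" and "i \<noteq> j"
  shows "X $ i $ j < X $ i $ i"
proof -
  interpret T: irreducible_balanced_matrix "transpose A"
    by (rule irreducible_balanced_matrix_transpose)
  show ?thesis
    using T.mp_inverse_less_diagonal_column[of "transpose X" j i]
      is_mp_inverse_transpose[OF assms(1)] assms(2)
    by (simp add: transpose_L) (simp add: transpose_def)
qed

lemma mp_inverse_triangle:
  assumes X: "is_mp_inverse L X"
  shows "X $ i $ j + X $ j $ k \<le> X $ j $ j + X $ i $ k"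
proof -
  \<comment> \<open>The terms 1/n cancel in the difference; what remains off \<open>j\<close> is -1
    at \<open>k\<close> or 0.\<close>
  have "(L *v (column j X - column k X)) $ a \<le> 0" if "a \<noteq> j" for a
    using that by (simp add: matrix_vector_mult_diff_distrib L_mult_column_mp_inverse[OF X])
  then have "(column j X - column k X) $ i \<le> (column j X - column k X) $ j"
    by (rule maximum_principle)
  then show ?thesis
    by (simp add: column_def)
qed

end

lemma irreducible_balanced_adj_matrix:
  fixes G :: "'n::finite pair_pre_digraph"
  assumes "pverts G = UNIV"
    and "strongly_connected (with_proj G)"
    and "balanced G"
  shows "irreducible_balanced_matrix (adj_matrix G)"
proof
  have arcs: "{(a, b). 0 < adj_matrix G $ a $ b} = parcs G"
    by (auto simp: adj_matrix_def)
  show "(i, j) \<in> {(a, b). 0 < adj_matrix G $ a $ b}\<^sup>*" for i j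
    unfolding arcs using assms(1,2) reachable_rtranclI[of "with_proj G" i j]
    by (auto simp: strongly_connected_def arcs_ends_def arc_to_ends_def)
  show "transpose (adj_matrix G) *v 1 = adj_matrix G *v 1"
    using assms(1,3)
    by (simp add: balanced_def vec_eq_iff matrix_vector_mult_def transpose_def
        flip: in_degree_eq_column_sum out_degree_eq_row_sum)
qed (simp add: adj_matrix_def)

theorem theorem3p3:
  fixes G :: "'n::finite pair_pre_digraph"
  assumes "pair_digraph G"
    and "pverts G = UNIV"
    and "strongly_connected (with_proj G)"
    and "balanced G"
  shows "(\<forall>i j. i \<noteq> j \<longrightarrow> 0 < resistance_matrix G $ i $ j) \<and>
         (\<forall>i j. 0 \<le> resistance_matrix G $ i $ j) \<and>
         (\<forall>i j k. resistance_matrix G $ i $ k \<le> resistance_matrix G $ i $ j + resistance_matrix G $ j $ k)"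
proof -
  interpret irreducible_balanced_matrix "adj_matrix G"
    by (rule irreducible_balanced_adj_matrix) (fact assms)+
  define M where "M = mp_inverse (laplacian G)"
  have M: "is_mp_inverse L M"
    unfolding M_def L_def laplacian_def by (rule is_mp_inverse_mp_inverse)
  have r: "resistance_matrix G $ i $ j = M $ i $ i + M $ j $ j - 2 * M $ i $ j" for i j
    by (simp add: resistance_matrix_def M_def)
  have pos: "0 < resistance_matrix G $ i $ j" if "i \<noteq> j" for i j
    using mp_inverse_less_diagonal_column[OF M that] mp_inverse_less_diagonal_row[OF M that]
    by (simp add: r)
  moreover have "0 \<le> resistance_matrix G $ i $ j" for i j
    using pos[of i j] by (cases "i = j") (simp_all add: r)
  \<comment> \<open>The slack is twice that of \<open>mp_inverse_triangle\<close>, since the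
    diagonal entries at \<open>i\<close> and \<open>k\<close> cancel.\<close>
  moreover have "resistance_matrix G $ i $ k \<le> resistance_matrix G $ i $ j + resistance_matrix G $ j $ k"
    for i j k
    using mp_inverse_triangle[OF M, of i j k] by (simp add: r)
  ultimately show ?thesis by blast
qed

end
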